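(* Let $(f_n)_{n\in\omega}$ be an admissible sequence and let $X\subseteq\mathbb{R}$ be an $(f_n)_n$-microscopic set satisfying at least one of the following conditions: (a) $X\in\mathrm{Micro}_{(f_n)_n}^{\star}$, i.e. $X$ is contained in an $\mathbf{F_\sigma}$ set which is $(f_n)_n$-microscopic; (b) the closure $\overline{X}$ is an unbounded interval; (c) $X$ is bounded. Then for any set $Y\subseteq\mathbb{R}$ of strong measure zero the union $X\cup Y$ is $(f_n)_n$-microscopic.
   Context: $\omega=\{0,1,2,\ldots\}$; $|J|$ denotes the length of an interval $J\subseteq\mathbb{R}$. An admissible sequence is a nonincreasing sequence $(f_n)_{n\in\omega}$ of functions $f_n\colon(0,1)\to(0,1)$ (i.e. $f_{n+1}(x)\le f_n(x)$ for all $n$ and $x$) such that: each $f_n$ is increasing; $\lim_{x\to0^+}f_n(x)=0$ for all $n$; and there exists $x_0$ such that for every $x\in(0,x_0)$ the series $\sum_{n\in\omega}f_n(x)$ converges. A set $M\subseteq\mathbb{R}$ is called $(f_n)_n$-microscopic if for every $\varepsilon\in(0,1)$ there is a sequence of intervals $(I_k)_{k\in\omega}$ such that $M\subseteq\bigcup_k I_k$ and $|I_k|\le f_k(\varepsilon)$ for all $k\in\omega$; $\mathrm{Micro}_{(f_n)_n}$ is the family of all such sets. For a family $\mathcal{A}$ of subsets of $\mathbb{R}$, $\mathcal{A}^{\star}$ denotes the family of all sets that can be covered by an $\mathbf{F_\sigma}$ set belonging to $\mathcal{A}$. A set $M\subseteq\mathbb{R}$ is of strong measure zero if for each sequence of positive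 reals $(\varepsilon_k)_{k\in\omega}$ there is a sequence of intervals $(I_k)_{k\in\omega}$ such that $M\subseteq\bigcup_k I_k$ and $|I_k|\le\varepsilon_k$ for all $k\in\omega$. *)

theory Defs
  imports "HOL-Analysis.Analysis"
begin

(* Functions (0,1) -> (0,1) are represented by total functions of type real => real;
   only their values on {0<..<1} matter. *)
definition admissible :: "(nat \<Rightarrow> real \<Rightarrow> real) \<Rightarrow> bool" where
  "admissible f \<longleftrightarrow>
     (\<forall>n. f n \<in> {0<..<1} \<rightarrow> {0<..<1}) \<and>
     (\<forall>n. \<forall>x\<in>{0<..<1}. f (Suc n) x \<le> f n x) \<and>
     (\<forall>n. strict_mono_on {0<..<1} (f n)) \<and>
     (\<forall>n. (f n \<longlongrightarrow> 0) (at_right 0)) \<and>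
     (\<exists>x0\<in>{0<..<1}. \<forall>x\<in>{0<..<x0}. summable (\<lambda>n. f n x))"

(* The length is measured by emeasure rather than the real-valued measure, since the latter
   would assign length 0 to unbounded intervals. *)
definition interval_cover :: "(nat \<Rightarrow> real) \<Rightarrow> real set \<Rightarrow> bool" where
  "interval_cover l M \<longleftrightarrow>
     (\<exists>I :: nat \<Rightarrow> real set. (\<forall>k. is_interval (I k)) \<and> M \<subseteq> (\<Union>k. I k) \<and>
        (\<forall>k. emeasure lborel (I k) \<le> ennreal (l k)))"

definition Micro :: "(nat \<Rightarrow> real \<Rightarrow> real) \<Rightarrow> real set set" where
  "Micro f = {M. \<forall>\<epsilon>\<in>{0<..<1}. interval_cover (\<lambda>k. f k \<epsilon>) M}"

definition star :: "real set set \<Rightarrow> real set set" where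
  "star \<A> = {M. \<exists>F\<in>\<A>. fsigma F \<and> M \<subseteq> F}"

definition strong_measure_zero :: "real set \<Rightarrow> bool" where
  "strong_measure_zero M \<longleftrightarrow>
     (\<forall>\<epsilon> :: nat \<Rightarrow> real. (\<forall>k. 0 < \<epsilon> k) \<longrightarrow> interval_cover \<epsilon> M)"

end

theory Submission
  imports Defs
begin

text \<open>
  It suffices to cover \<open>X\<close> with intervals of lengths \<open>f k \<epsilon>\<close> using an index set whose complement
  is infinite: the strong measure zero set \<open>Y\<close> can be covered with the spare indices. If infinitely
  many intervals of a cover accumulate at a point, a single further interval around that point
  absorbs infinitely many of them, so infinitely many indices become spare at the cost of one.

  For bounded \<open>X\<close> the cost can be met by covering \<open>X\<close> with the indices \<open>k \<ge> m\<close> only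
  (pigeonhole principle).
  For an \<open>F\<^sub>\<sigma>\<close> set the same fact applied to its compact pieces gives finite blocks of
  indices with gaps between them. If the closure of \<open>X\<close> is an unbounded interval, the slack
  \<open>f 0 \<epsilon> - f 0 \<delta>\<close> suffices: intervals of lengths \<open>f k \<delta>\<close> can only fill a bounded part of the
  closure by finitely many, and just beyond the end of that part there are infinitely many others.
\<close>

section \<open>Covers by closed intervals over an index set\<close>

text \<open>The set \<open>S\<close> records which lengths are spent, so that spare indices can be
  tracked; normalising to closed intervals reduces a cover to its left endpoints
  \<open>a\<close>.\<close>

definition covered :: "nat set \<Rightarrow> (nat \<Rightarrow> real) \<Rightarrow> real set \<Rightarrow> bool" where
  "covered S l M \<longleftrightarrow> (\<exists>a. M \<subseteq> (\<Union>k\<in>S. {a k..a k + l k}))"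

text \<open>The segment between two points of \<open>I\<close> lies in \<open>I\<close>, so
  distances in \<open>I\<close> are at most \<open>L\<close>, and \<open>Inf I\<close> can serve as
  left endpoint.\<close>

lemma is_interval_subset_Icc:
  fixes I :: "real set"
  assumes "is_interval I" "emeasure lborel I \<le> ennreal L" "0 \<le> L"
  shows "\<exists>a. I \<subseteq> {a..a + L}"
proof (cases "I = {}")
  case False
  have diff: "y - x \<le> L" if "x \<in> I" "y \<in> I" for x y
  proof (cases "x \<le> y")
    case True
    have sub: "{x..y} \<subseteq> I"
      using mem_is_interval_1_I[OF assms(1) that] by auto
    have "I \<in> sets lborel"
      using real_interval_borel_measurable[OF assms(1)] by simp
    with sub have "emeasure lborel {x..y} \<le> emeasure lborel I"
      by (rule emeasure_mono)
    also have "\<dots> \<le> ennreal L"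
      by (rule assms(2))
    finally have "emeasure lborel {x..y} \<le> ennreal L" .
    then show ?thesis
      using True assms(3) by simp
  qed (use assms(3) in auto)
  obtain x0 where x0: "x0 \<in> I" using False by blast
  have "bdd_below I"
    using diff[OF _ x0] by (intro bdd_belowI[of _ "x0 - L"]) (simp add: algebra_simps)
  then have "Inf I \<le> y" if "y \<in> I" for y
    using that by (rule cInf_lower[rotated])
  moreover have "y \<le> Inf I + L" if "y \<in> I" for y
    using cInf_greatest[OF False, of "y - L"] diff[OF _ that] by (simp add: algebra_simps)
  ultimately show ?thesis
    by (intro exI[of _ "Inf I"]) auto
qed auto

lemma interval_cover_iff:
  assumes "\<And>k. 0 \<le> l k"
  shows "interval_cover l M \<longleftrightarrow> covered UNIV l M"
proof
  assume "interval_cover l M"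
  then obtain I where I: "\<And>k. is_interval (I k)" "M \<subseteq> (\<Union>k. I k)"
      "\<And>k. emeasure lborel (I k) \<le> ennreal (l k)"
    unfolding interval_cover_def by blast
  have "\<exists>a. \<forall>k. I k \<subseteq> {a k..a k + l k}"
    using is_interval_subset_Icc[OF I(1,3) assms] by (intro choice allI)
  then obtain a where "\<And>k. I k \<subseteq> {a k..a k + l k}"
    by blast
  then have "(\<Union>k. I k) \<subseteq> (\<Union>k. {a k..a k + l k})"
    by (rule UN_mono[OF order_refl])
  then show "covered UNIV l M"
    unfolding covered_def by (intro exI[of _ a] order_trans[OF I(2)])
next
  assume "covered UNIV l M"
  then obtain a where "M \<subseteq> (\<Union>k. {a k..a k + l k})"
    unfolding covered_def by blast
  then show "interval_cover l M"
    unfolding interval_cover_def using assms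
    by (intro exI[of _ "\<lambda>k. {a k..a k + l k}"]) (auto simp: is_interval_cc)
qed

lemma covered_subset:
  assumes "covered S l M" "N \<subseteq> M"
  shows "covered S l N"
proof -
  obtain a where "M \<subseteq> (\<Union>k\<in>S. {a k..a k + l k})"
    using assms(1) unfolding covered_def by blast
  then show ?thesis
    unfolding covered_def by (intro exI[of _ a] order_trans[OF assms(2)])
qed

lemma covered_reindex:
  assumes "covered S l M" "inj_on \<phi> S" "\<phi> ` S \<subseteq> T" "\<And>k. k \<in> S \<Longrightarrow> l k \<le> l' (\<phi> k)"
  shows "covered T l' M"
proof -
  obtain a where a: "M \<subseteq> (\<Union>k\<in>S. {a k..a k + l k})"
    using assms(1) unfolding covered_def by blast
  have "M \<subseteq> (\<Union>j\<in>T. {a (the_inv_into S \<phi> j)..a (the_inv_into S \<phi> j) + l' j})"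
  proof
    fix x assume "x \<in> M"
    then obtain k where k: "k \<in> S" "x \<in> {a k..a k + l k}" using a by blast
    then have "x \<in> {a k..a k + l' (\<phi> k)}" using assms(4)[of k] by auto
    moreover have "\<phi> k \<in> T" "the_inv_into S \<phi> (\<phi> k) = k"
      using k assms(2,3) by (auto simp: the_inv_into_f_f)
    ultimately show "x \<in> (\<Union>j\<in>T. {a (the_inv_into S \<phi> j)..a (the_inv_into S \<phi> j) + l' j})"
      by (intro UN_I[of "\<phi> k"]) auto
  qed
  then show ?thesis unfolding covered_def by (intro exI)
qed

lemma covered_mono:
  assumes "covered S l M" "S \<subseteq> T" "\<And>k. k \<in> S \<Longrightarrow> l k \<le> l' k"
  shows "covered T l' M"
  using covered_reindex[OF assms(1), of id T l'] assms(2,3) by auto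

text \<open>Disjointness means that each index is asked for only one left endpoint, so the families
  \<open>a n\<close> glue to a single \<open>b\<close>.\<close>

lemma covered_UN:
  assumes "\<And>n. n \<in> A \<Longrightarrow> covered (S n) l (M n)" "disjoint_family_on S A"
  shows "covered (\<Union>n\<in>A. S n) l (\<Union>n\<in>A. M n)"
proof -
  have "\<exists>a. \<forall>n\<in>A. M n \<subseteq> (\<Union>k\<in>S n. {a n k..a n k + l k})"
    using assms(1) unfolding covered_def by (intro bchoice) blast
  then obtain a where a: "\<And>n. n \<in> A \<Longrightarrow> M n \<subseteq> (\<Union>k\<in>S n. {a n k..a n k + l k})"
    by blast
  define b where "b k = a (THE n. n \<in> A \<and> k \<in> S n) k" for k
  have b: "b k = a n k" if "n \<in> A" "k \<in> S n" for n k
  proof -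
    have "(THE n. n \<in> A \<and> k \<in> S n) = n"
      using that assms(2) unfolding disjoint_family_on_def by (intro the_equality) blast+
    then show ?thesis by (simp add: b_def)
  qed
  have "M n \<subseteq> (\<Union>k\<in>(\<Union>n\<in>A. S n). {b k..b k + l k})" if "n \<in> A" for n
  proof
    fix x assume "x \<in> M n"
    then obtain k where "k \<in> S n" "x \<in> {a n k..a n k + l k}"
      using a[OF \<open>n \<in> A\<close>] by blast
    then show "x \<in> (\<Union>k\<in>(\<Union>n\<in>A. S n). {b k..b k + l k})"
      using b[OF \<open>n \<in> A\<close>] that by (intro UN_I[of k]) auto
  qed
  then show ?thesis
    unfolding covered_def by (intro exI[of _ b] UN_least)
qed

lemma covered_Un:
  assumes "covered S l M" "covered T l N" "S \<inter> T = {}"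
  shows "covered (S \<union> T) l (M \<union> N)"
proof -
  have "covered (\<Union>n\<in>{True, False}. if n then S else T) l (\<Union>n\<in>{True, False}. if n then M else N)"
    using assms by (intro covered_UN) (auto simp: disjoint_family_on_def)
  then show ?thesis by (simp add: Un_commute)
qed

lemma covered_uminus_image:
  assumes "covered S l M"
  shows "covered S l (uminus ` M)"
proof -
  obtain a where a: "M \<subseteq> (\<Union>k\<in>S. {a k..a k + l k})"
    using assms unfolding covered_def by blast
  have "uminus ` M \<subseteq> (\<Union>k\<in>S. {(- a k - l k)..(- a k - l k) + l k})"
  proof
    fix x assume "x \<in> uminus ` M"
    then obtain k where "k \<in> S" "- x \<in> {a k..a k + l k}"
      using a by auto
    then show "x \<in> (\<Union>k\<in>S. {(- a k - l k)..(- a k - l k) + l k})"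
      by (intro UN_I[of k]) auto
  qed
  then show ?thesis
    unfolding covered_def by (intro exI[of _ "\<lambda>k. - a k - l k"])
qed

text \<open>The intervals are laid end to end, starting at \<open>u\<close>.\<close>

lemma covered_Icc:
  assumes "finite D" "D \<noteq> {}" "r - u \<le> (\<Sum>k\<in>D. l k)"
  shows "covered D l {u..r}"
  using assms
proof (induction D arbitrary: u rule: finite_ne_induct)
  case (singleton k)
  then show ?case
    unfolding covered_def by (intro exI[of _ "\<lambda>_. u"]) auto
next
  case (insert k D)
  have "covered D l {u + l k..r}"
    using insert by (intro insert.IH) auto
  moreover have "covered {k} l {u..u + l k}"
    unfolding covered_def by (intro exI[of _ "\<lambda>_. u"]) auto
  ultimately have "covered ({k} \<union> D) l ({u..u + l k} \<union> {u + l k..r})"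
    using insert.hyps by (intro covered_Un) auto
  then have "covered (insert k D) l ({u..u + l k} \<union> {u + l k..r})" by simp
  then show ?case by (rule covered_subset) auto
qed

text \<open>The old intervals with indices in \<open>B\<close> or \<open>D\<close> are swallowed by
  new ones that use only indices in \<open>D\<close>; all others stay in place. The indices in
  \<open>B - D\<close> become spare.\<close>

lemma covered_absorb:
  assumes "X \<subseteq> (\<Union>k\<in>S. {a k..a k + g k})" "\<And>k. k \<in> S \<Longrightarrow> g k \<le> h k"
    and "covered D h (\<Union>k\<in>S \<inter> (B \<union> D). {a k..a k + g k})"
  shows "covered (D \<union> (S - B)) h X"
proof -
  have "covered (S - B - D) g (\<Union>k\<in>S - B - D. {a k..a k + g k})"
    unfolding covered_def by blast
  then have "covered (S - B - D) h (\<Union>k\<in>S - B - D. {a k..a k + g k})"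
    using covered_mono[OF _ order_refl] assms(2) by blast
  then have "covered (D \<union> (S - B - D)) h
      ((\<Union>k\<in>S \<inter> (B \<union> D). {a k..a k + g k}) \<union> (\<Union>k\<in>S - B - D. {a k..a k + g k}))"
    using assms(3) by (intro covered_Un) auto
  then have "covered (D \<union> (S - B - D)) h X"
  proof (rule covered_subset)
    show "X \<subseteq> (\<Union>k\<in>S \<inter> (B \<union> D). {a k..a k + g k}) \<union> (\<Union>k\<in>S - B - D. {a k..a k + g k})"
      using assms(1) by blast
  qed
  moreover have "D \<union> (S - B - D) = D \<union> (S - B)" by blast
  ultimately show ?thesis by simp
qed

text \<open>Half of the slack \<open>h k - g k\<close> is added on each side of an interval; the
  resulting open intervals admit a finite subcover.\<close>

lemma compact_covered_finite:
  assumes "compact K" "covered S g K" "\<And>k. k \<in> S \<Longrightarrow> g k < h k"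
  shows "\<exists>T. finite T \<and> T \<subseteq> S \<and> covered T h K"
proof -
  obtain a where a: "K \<subseteq> (\<Union>k\<in>S. {a k..a k + g k})"
    using assms(2) unfolding covered_def by blast
  let ?b = "\<lambda>k. a k - (h k - g k) / 2"
  have "K \<subseteq> (\<Union>k\<in>S. {?b k<..<?b k + h k})"
  proof
    fix x assume "x \<in> K"
    then obtain k where k: "k \<in> S" "x \<in> {a k..a k + g k}" using a by blast
    then have "x \<in> {?b k<..<?b k + h k}"
      using assms(3)[of k] by (auto simp: field_simps)
    then show "x \<in> (\<Union>k\<in>S. {?b k<..<?b k + h k})" using k by blast
  qed
  then obtain T where T: "T \<subseteq> S" "finite T" "K \<subseteq> (\<Union>k\<in>T. {?b k<..<?b k + h k})"
    using compactE_image[OF assms(1), of S "\<lambda>k. {?b k<..<?b k + h k}"] by auto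
  have "(\<Union>k\<in>T. {?b k<..<?b k + h k}) \<subseteq> (\<Union>k\<in>T. {?b k..?b k + h k})"
    by (intro UN_mono) auto
  with T(3) have "K \<subseteq> (\<Union>k\<in>T. {?b k..?b k + h k})"
    by (rule order_trans)
  then have "covered T h K"
    unfolding covered_def by (intro exI[of _ ?b])
  then show ?thesis using T by blast
qed

section \<open>Spare indices from accumulating intervals\<close>

text \<open>The definition is applied to the lengths listed along the enumeration of
  \<open>S\<close>.\<close>

lemma strong_measure_zero_covered:
  assumes "strong_measure_zero Y" "infinite S" "\<And>k. 0 < l k"
  shows "covered S l Y"
proof -
  have "covered UNIV (\<lambda>j. l (enumerate S j)) Y"
    using assms(1,3) interval_cover_iff[of "\<lambda>j. l (enumerate S j)" Y]
    by (auto simp: strong_measure_zero_def less_imp_le)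
  then show ?thesis
    by (rule covered_reindex[where \<phi> = "enumerate S"])
      (use assms(2) in \<open>auto simp: inj_enumerate enumerate_in_set\<close>)
qed

text \<open>Bolzano-Weierstrass along the enumeration of \<open>S\<close>. Indices are counted, not
  values, so \<open>c\<close> may repeat values.\<close>

lemma bounded_infinite_accumulation:
  fixes c :: "nat \<Rightarrow> real"
  assumes "infinite S" "bounded (c ` S)"
  shows "\<exists>p. \<forall>e>0. infinite {k\<in>S. \<bar>c k - p\<bar> < e}"
proof -
  have "bounded (range (\<lambda>n. c (enumerate S n)))"
    using enumerate_in_set[OF assms(1)] by (intro bounded_subset[OF assms(2)] image_subsetI imageI)
  then obtain p r where r: "strict_mono r" "((\<lambda>n. c (enumerate S n)) \<circ> r) \<longlonglongrightarrow> p"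
    using bounded_imp_convergent_subsequence[of "\<lambda>n. c (enumerate S n)"] by blast
  have "infinite {k\<in>S. \<bar>c k - p\<bar> < e}" if e: "e > 0" for e
  proof -
    obtain N where N: "\<And>n. n \<ge> N \<Longrightarrow> \<bar>c (enumerate S (r n)) - p\<bar> < e"
      using r(2) e by (auto simp: LIMSEQ_iff)
    have "inj (\<lambda>n. enumerate S (r n))"
      using inj_compose[OF inj_enumerate[OF assms(1)] strict_mono_imp_inj_on[OF r(1)]]
      by (simp add: comp_def)
    then have "inj_on (\<lambda>n. enumerate S (r n)) {N..}"
      by (rule inj_on_subset) simp
    then have "infinite ((\<lambda>n. enumerate S (r n)) ` {N..})"
      by (simp add: finite_image_iff infinite_Ici)
    moreover have "(\<lambda>n. enumerate S (r n)) ` {N..} \<subseteq> {k\<in>S. \<bar>c k - p\<bar> < e}"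
      using N enumerate_in_set[OF assms(1)] by auto
    ultimately show ?thesis using infinite_super by blast
  qed
  then show ?thesis by blast
qed

lemma infinite_Collect_small:
  fixes l :: "nat \<Rightarrow> real"
  assumes "infinite B" "l \<longlonglongrightarrow> 0" "0 < e"
  shows "infinite {k\<in>B. l k < e}"
proof -
  have "eventually (\<lambda>k. l k < e) sequentially"
    using assms(2,3) by (rule order_tendstoD)
  then obtain N where "\<And>k. k \<ge> N \<Longrightarrow> l k < e"
    by (auto simp: eventually_sequentially)
  then have "B \<subseteq> {k\<in>B. l k < e} \<union> {..<N}"
    by (auto simp: not_less)
  then show ?thesis
    using assms(1) finite_subset by fastforce
qed

text \<open>Index 0 is still free in the given cover; it is spent on an interval around an
  accumulation point of the left endpoints.\<close>

lemma bounded_covered_spare: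
  assumes cov: "covered {1..} l X" and X: "bounded X" and l: "\<And>k. 0 < l k" "l \<longlonglongrightarrow> 0"
  shows "\<exists>T. infinite (- T) \<and> covered T l X"
proof -
  obtain a where a: "X \<subseteq> (\<Union>k\<in>{1..}. {a k..a k + l k})"
    using cov unfolding covered_def by blast
  \<comment> \<open>Intervals that miss \<open>X\<close> are discarded, so the remaining left
    endpoints are bounded.\<close>
  define S where "S = {k\<in>{1..}. {a k..a k + l k} \<inter> X \<noteq> {}}"
  have XS: "X \<subseteq> (\<Union>k\<in>S. {a k..a k + l k})"
    using a unfolding S_def by blast
  show ?thesis
  proof (cases "finite S")
    case True
    then have "infinite (- S)" by (simp add: finite_compl)
    then show ?thesis using XS unfolding covered_def by blast
  next
    case False
    obtain b where b: "\<And>x. x \<in> X \<Longrightarrow> \<bar>x\<bar> \<le> b"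
      using X by (auto simp: bounded_iff)
    obtain L where L: "\<And>k. \<bar>l k\<bar> \<le> L"
      using convergent_imp_Bseq[OF convergentI[OF l(2)]] by (auto simp: Bseq_def)
    have "\<bar>a k\<bar> \<le> b + L" if k: "k \<in> S" for k
    proof -
      obtain x where x: "x \<in> X" "a k \<le> x" "x \<le> a k + l k"
        using k by (auto simp: S_def)
      then show ?thesis using b[OF x(1)] L[of k] by linarith
    qed
    then have "bounded (a ` S)"
      by (auto simp: bounded_iff)
    then obtain p where p: "\<And>e. e > 0 \<Longrightarrow> infinite {k\<in>S. \<bar>a k - p\<bar> < e}"
      using bounded_infinite_accumulation False by blast
    \<comment> \<open>A left endpoint within \<open>l 0 / 4\<close> of \<open>p\<close> and a length
      below \<open>l 0 / 4\<close> keep the interval within \<open>l 0 / 2\<close> of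
      \<open>p\<close>.\<close>
    define B where "B = {k\<in>{k\<in>S. \<bar>a k - p\<bar> < l 0 / 4}. l k < l 0 / 4}"
    have "infinite B"
      unfolding B_def using l by (intro infinite_Collect_small p) auto
    have "(\<Union>k\<in>S \<inter> (B \<union> {0}). {a k..a k + l k}) \<subseteq> {p - l 0 / 2..p - l 0 / 2 + l 0}"
    proof
      fix x assume "x \<in> (\<Union>k\<in>S \<inter> (B \<union> {0}). {a k..a k + l k})"
      then obtain k where "k \<in> B" "a k \<le> x" "x \<le> a k + l k"
        by (auto simp: S_def)
      then show "x \<in> {p - l 0 / 2..p - l 0 / 2 + l 0}"
        unfolding B_def using l(1)[of 0] by (auto simp: abs_less_iff abs_if split: if_splits)
    qed
    then have "covered {0} l (\<Union>k\<in>S \<inter> (B \<union> {0}). {a k..a k + l k})"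
      unfolding covered_def by (intro exI[of _ "\<lambda>_. p - l 0 / 2"]) auto
    then have "covered ({0} \<union> (S - B)) l X"
      by (rule covered_absorb[OF XS order_refl])
    moreover have "B \<subseteq> - ({0} \<union> (S - B))"
      by (auto simp: B_def S_def)
    ultimately show ?thesis
      using \<open>infinite B\<close> infinite_super by blast
  qed
qed

section \<open>Sets whose closure contains a ray\<close>

lemma Icc_length_le_sum:
  fixes u r :: real
  assumes "finite D" "{u..r} \<subseteq> (\<Union>k\<in>D. {a k..a k + l k})" "\<And>k. 0 \<le> l k"
  shows "r - u \<le> (\<Sum>k\<in>D. l k)"
proof (cases "u \<le> r")
  case True
  have "emeasure lborel {u..r} \<le> emeasure lborel (\<Union>k\<in>D. {a k..a k + l k})"
    using assms(1,2) by (intro emeasure_mono) auto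
  also have "\<dots> \<le> (\<Sum>k\<in>D. emeasure lborel {a k..a k + l k})"
    using assms(1) by (intro emeasure_subadditive_finite) auto
  also have "\<dots> = ennreal (\<Sum>k\<in>D. l k)"
    using assms(3) by (simp add: sum_ennreal)
  finally show ?thesis
    using True assms(3) by (simp add: sum_nonneg)
next
  case False
  then show ?thesis
    using sum_nonneg[of D l] assms(3) by simp
qed

text \<open>Summability of \<open>g\<close> bounds the segments that finitely many intervals can
  fill. Strictness at index 0 alone supplies the slack.\<close>

lemma unbounded_covered_spare:
  assumes cov: "covered UNIV g X"
    and g: "\<And>k. 0 \<le> g k" "summable g"
    and h: "\<And>k. g k \<le> h k" "g 0 < h 0"
    and X: "X \<noteq> {}" "\<And>q. q \<in> closure X \<Longrightarrow> {q..} \<subseteq> closure X"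
  shows "\<exists>T. infinite (- T) \<and> covered T h X"
proof -
  \<comment> \<open>The slack sits at index 0, so that interval has to meet the closure. If it does
    not, it covers no point of \<open>X\<close> and can be moved to start in
    \<open>X\<close>.\<close>
  have "\<exists>a q. X \<subseteq> (\<Union>k. {a k..a k + g k}) \<and> q \<in> closure X \<and> q \<in> {a 0..a 0 + g 0}"
  proof -
    obtain a where a: "X \<subseteq> (\<Union>k. {a k..a k + g k})"
      using cov unfolding covered_def by blast
    show ?thesis
    proof (cases "{a 0..a 0 + g 0} \<inter> closure X = {}")
      case True
      obtain q where q: "q \<in> X" using X(1) by blast
      have "X \<subseteq> (\<Union>k. {(a(0 := q)) k..(a(0 := q)) k + g k})"
      proof
        fix x assume x: "x \<in> X"
        then obtain k where k: "x \<in> {a k..a k + g k}" using a by blast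
        moreover have "k \<noteq> 0"
          using True k x closure_subset[of X] by (cases k) auto
        ultimately show "x \<in> (\<Union>k. {(a(0 := q)) k..(a(0 := q)) k + g k})"
          by (intro UN_I[of k]) auto
      qed
      then show ?thesis
        using q closure_subset[of X] g(1)[of 0]
        by (intro exI[of _ "a(0 := q)"] exI[of _ q]) auto
    next
      case False
      then show ?thesis using a by blast
    qed
  qed
  then obtain a q where a: "X \<subseteq> (\<Union>k. {a k..a k + g k})"
      and q: "q \<in> closure X" "q \<in> {a 0..a 0 + g 0}"
    by blast
  define s where "s = h 0 - g 0"
  have s: "s > 0" using h(2) by (simp add: s_def)
  \<comment> \<open>Infinitely many intervals meet \<open>[q, Sup A + s / 4]\<close>, while finitely many (those in \<open>D\<close>)
    cover \<open>[q, t]\<close> for some \<open>t\<close> just below \<open>Sup A\<close>; extending the union of the latter by the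
    slack \<open>s\<close> absorbs almost all of the former.\<close>
  define A where "A = {t. q \<le> t \<and> (\<exists>D. finite D \<and> {q..t} \<subseteq> (\<Union>k\<in>D. {a k..a k + g k}))}"
  have qA: "q \<in> A"
    using q(2) by (auto simp: A_def intro!: exI[of _ "{0}"])
  have "t \<le> q + suminf g" if "t \<in> A" for t
  proof -
    obtain D where D: "finite D" "{q..t} \<subseteq> (\<Union>k\<in>D. {a k..a k + g k})"
      using \<open>t \<in> A\<close> by (auto simp: A_def)
    have "t - q \<le> sum g D"
      using Icc_length_le_sum[OF D g(1)] .
    also have "\<dots> \<le> suminf g"
      using D(1) g by (intro sum_le_suminf) auto
    finally show ?thesis by simp
  qed
  then have A: "bdd_above A"
    by (auto simp: bdd_above_def)
  have "\<exists>t\<in>A. Sup A - s / 4 < t"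
    using qA A s less_cSup_iff[of A "Sup A - s / 4"] by auto
  then obtain t where t: "t \<in> A" "Sup A - s / 4 < t" by blast
  define u where "u = Sup A + s / 4"
  have "q \<le> Sup A" using qA A by (rule cSup_upper)
  then have qu: "q < u" using s by (simp add: u_def)
  have "u \<notin> A"
    using cSup_upper[of u A] A s by (auto simp: u_def)
  obtain D0 where D0: "finite D0" "{q..t} \<subseteq> (\<Union>k\<in>D0. {a k..a k + g k})"
    using t(1) by (auto simp: A_def)
  \<comment> \<open>Only intervals meeting \<open>{q..t}\<close> are kept, so that their union is
    connected and hence a single segment. Index 0 is added for its slack; its interval contains
    \<open>q\<close>.\<close>
  define D where "D = insert 0 {k\<in>D0. {q..t} \<inter> {a k..a k + g k} \<noteq> {}}"
  have D: "finite D" "0 \<in> D" using D0(1) by (auto simp: D_def)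
  have qt: "q \<le> t" using t(1) by (simp add: A_def)
  have subD: "{q..t} \<subseteq> (\<Union>k\<in>D. {a k..a k + g k})"
  proof
    fix x assume x: "x \<in> {q..t}"
    then obtain k where "k \<in> D0" "x \<in> {a k..a k + g k}" using D0(2) by blast
    then show "x \<in> (\<Union>k\<in>D. {a k..a k + g k})"
      using x unfolding D_def by (intro UN_I[of k]) blast+
  qed
  have "connected ({q..t} \<union> (\<Union>k\<in>D. {a k..a k + g k}))"
  proof (rule connected_Un_UN)
    fix J assume "J \<in> (\<lambda>k. {a k..a k + g k}) ` D"
    then obtain k where k: "k \<in> D" "J = {a k..a k + g k}" by blast
    show "connected J" using k by simp
    show "{q..t} \<inter> J \<noteq> {}"
    proof (cases "k = 0")
      case True
      then have "q \<in> {q..t} \<inter> J" using q(2) qt k by simp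
      then show ?thesis by blast
    qed (use k in \<open>simp add: D_def\<close>)
  qed simp
  moreover have "{q..t} \<union> (\<Union>k\<in>D. {a k..a k + g k}) = (\<Union>k\<in>D. {a k..a k + g k})"
    using subD by blast
  ultimately have "connected (\<Union>k\<in>D. {a k..a k + g k})" by simp
  moreover have "compact (\<Union>k\<in>D. {a k..a k + g k})"
    using D(1) by (intro compact_UN) auto
  ultimately obtain l r where lr: "(\<Union>k\<in>D. {a k..a k + g k}) = {l..r}"
    using connected_compact_interval_1[of "\<Union>k\<in>D. {a k..a k + g k}"] by auto
  have "l \<le> q" "t \<le> r"
    using subD qt unfolding lr by auto
  have "r - l \<le> sum g D"
    using D(1) g(1) lr by (intro Icc_length_le_sum) auto
  define E where "E = {k. {a k..a k + g k} \<inter> {q..u} \<noteq> {}}"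
  \<comment> \<open>Otherwise the union over \<open>E\<close> is closed and contains the points of
    \<open>X\<close> between \<open>q\<close> and \<open>u\<close>, which are dense there. It would
    then contain \<open>{q..u}\<close>, putting \<open>u > Sup A\<close> into
    \<open>A\<close>.\<close>
  have "infinite E"
  proof
    assume E: "finite E"
    have cl: "closed (\<Union>k\<in>E. {a k..a k + g k})"
      using E by (intro closed_UN) auto
    have "{q<..<u} \<subseteq> {q<..<u} \<inter> closure X"
      using X(2)[OF q(1)] by auto
    also have "\<dots> \<subseteq> closure ({q<..<u} \<inter> X)"
      by (intro open_Int_closure_subset) auto
    also have "\<dots> \<subseteq> (\<Union>k\<in>E. {a k..a k + g k})"
    proof (intro closure_minimal[OF _ cl] subsetI)
      fix x assume x: "x \<in> {q<..<u} \<inter> X"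
      then obtain k where k: "x \<in> {a k..a k + g k}" using a by blast
      then have "k \<in> E" using x by (auto simp: E_def)
      then show "x \<in> (\<Union>k\<in>E. {a k..a k + g k})" using k by blast
    qed
    finally have "closure {q<..<u} \<subseteq> (\<Union>k\<in>E. {a k..a k + g k})"
      using cl by (rule closure_minimal)
    then have "u \<in> A"
      using qu E by (auto simp: A_def)
    then show False using \<open>u \<notin> A\<close> by blast
  qed
  define B where "B = {k\<in>E. g k < s / 4}"
  have "infinite B"
    unfolding B_def using \<open>infinite E\<close> summable_LIMSEQ_zero[OF g(2)] s
    by (intro infinite_Collect_small) auto
  \<comment> \<open>An interval with index in \<open>B\<close> reaches at most \<open>s / 4\<close>
    beyond \<open>{q..u}\<close>, and \<open>u + s / 4 = Sup A + s / 2 < t + 3 * s / 4\<close>. The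
    target is longer than \<open>{l..r}\<close> by exactly \<open>s\<close>.\<close>
  have "(\<Union>k\<in>UNIV \<inter> (B \<union> D). {a k..a k + g k}) \<subseteq> {l - s / 4..r + 3 * s / 4}"
  proof
    fix x assume "x \<in> (\<Union>k\<in>UNIV \<inter> (B \<union> D). {a k..a k + g k})"
    then obtain k where k: "k \<in> B \<or> k \<in> D" "x \<in> {a k..a k + g k}" by blast
    show "x \<in> {l - s / 4..r + 3 * s / 4}"
    proof (cases "k \<in> D")
      case True
      then have "x \<in> {l..r}" using k(2) lr by blast
      then show ?thesis using s by auto
    next
      case False
      then have "k \<in> B" using k by blast
      then have "{a k..a k + g k} \<inter> {q..u} \<noteq> {}" "g k < s / 4"
        unfolding B_def E_def by blast+
      then obtain y where "y \<in> {a k..a k + g k}" "q \<le> y" "y \<le> u" "g k < s / 4"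
        by fastforce
      then show ?thesis
        using k(2) \<open>l \<le> q\<close> \<open>t \<le> r\<close> t(2) by (auto simp: u_def)
    qed
  qed
  moreover have "covered D h {l - s / 4..r + 3 * s / 4}"
  proof (rule covered_Icc)
    have "sum g (D - {0}) \<le> sum h (D - {0})"
      using h(1) by (rule sum_mono)
    then have "sum g D + s \<le> sum h D"
      using D by (simp add: s_def sum.remove[of D 0])
    then show "r + 3 * s / 4 - (l - s / 4) \<le> sum h D"
      using \<open>r - l \<le> sum g D\<close> by simp
  qed (use D in auto)
  ultimately have "covered D h (\<Union>k\<in>UNIV \<inter> (B \<union> D). {a k..a k + g k})"
    by (rule covered_subset[rotated])
  then have "covered (D \<union> (UNIV - B)) h X"
    using h(1) by (intro covered_absorb[OF a])
  moreover have "- (D \<union> (UNIV - B)) = B - D" by blast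
  ultimately show ?thesis
    using \<open>infinite B\<close> D(1) by (intro exI[of _ "D \<union> (UNIV - B)"]) simp
qed

section \<open>Countable unions covered by blocks of indices\<close>

text \<open>Dependent choice gives block boundaries \<open>N n\<close> such that \<open>K n\<close>
  uses only indices strictly between \<open>N n\<close> and \<open>N (Suc n)\<close>; the boundaries
  themselves stay spare.\<close>

lemma sigma_covered_spare:
  fixes K :: "nat \<Rightarrow> real set"
  assumes "\<And>n m. \<exists>N>m. covered {Suc m..<N} l (K n)"
  shows "\<exists>T. infinite (- T) \<and> covered T l (\<Union>n. K n)"
proof -
  have "\<exists>N. \<forall>n. True \<and> (N n < N (Suc n) \<and> covered {Suc (N n)..<N (Suc n)} l (K n))"
    using assms by (intro dependent_nat_choice) auto
  then obtain N where N: "\<And>n. N n < N (Suc n)" "\<And>n. covered {Suc (N n)..<N (Suc n)} l (K n)"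
    by blast
  have mono: "strict_mono N" using N(1) by (simp add: strict_mono_Suc_iff)
  have le: "N (Suc i) \<le> N j" if "i < j" for i j
    using mono that by (simp add: strict_mono_less_eq)
  have "disjoint_family_on (\<lambda>n. {Suc (N n)..<N (Suc n)}) UNIV"
    unfolding disjoint_family_on_def
  proof (intro ballI impI)
    fix i j :: nat assume "i \<noteq> j"
    then consider "i < j" | "j < i" by linarith
    then show "{Suc (N i)..<N (Suc i)} \<inter> {Suc (N j)..<N (Suc j)} = {}"
      by cases (use le in fastforce)+
  qed
  then have "covered (\<Union>n. {Suc (N n)..<N (Suc n)}) l (\<Union>n. K n)"
    using N(2) by (intro covered_UN)
  moreover have "N j \<notin> {Suc (N i)..<N (Suc i)}" for i j
    using strict_mono_less[OF mono, of i j] strict_mono_less[OF mono, of j "Suc i"] by auto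
  then have "range N \<subseteq> - (\<Union>n. {Suc (N n)..<N (Suc n)})"
    by blast
  moreover have "infinite (range N)"
    using mono by (simp add: range_inj_infinite strict_mono_imp_inj_on)
  ultimately show ?thesis
    using infinite_super by blast
qed

section \<open>Admissible sequences and the pigeonhole argument\<close>

lemma
  assumes "admissible f" "x \<in> {0<..<1}"
  shows admissible_pos: "0 < f k x" and admissible_less_1: "f k x < 1"
proof -
  have "f k \<in> {0<..<1} \<rightarrow> {0<..<1}"
    using assms(1) by (simp add: admissible_def)
  from funcset_mem[OF this assms(2)] show "0 < f k x" "f k x < 1" by auto
qed

lemma admissible_antimono:
  assumes "admissible f" "x \<in> {0<..<1}" "i \<le> j"
  shows "f j x \<le> f i x"
  by (rule lift_Suc_antimono_le[of "\<lambda>k. f k x"]) (use assms in \<open>simp_all add: admissible_def\<close>)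

lemma admissible_strict_mono:
  assumes "admissible f" "0 < x" "x < y" "y < 1"
  shows "f k x < f k y"
proof -
  have "strict_mono_on {0<..<1} (f k)"
    using assms(1) by (simp add: admissible_def)
  then show ?thesis
    by (rule strict_mono_onD) (use assms in auto)
qed

lemma Micro_covered:
  assumes "admissible f" "X \<in> Micro f" "\<epsilon> \<in> {0<..<1}"
  shows "covered UNIV (\<lambda>k. f k \<epsilon>) X"
  using assms interval_cover_iff[of "\<lambda>k. f k \<epsilon>" X] admissible_pos
  by (auto simp: Micro_def less_imp_le)

text \<open>Pigeonhole principle: otherwise the fibres hold at most \<open>card V * m\<close>
  indices altogether.\<close>

lemma ex_fibre_card_gt:
  assumes "finite V" "\<And>k. k < M \<Longrightarrow> c k \<in> V" "card V * m < M"
  shows "\<exists>z\<in>V. m < card {k. k < M \<and> c k = z}"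
proof (rule ccontr)
  assume "\<not> ?thesis"
  then have le: "card {k. k < M \<and> c k = z} \<le> m" if "z \<in> V" for z
    using that by (simp add: not_less)
  have "{..<M} = (\<Union>z\<in>V. {k. k < M \<and> c k = z})"
    using assms(2) by auto
  then have "M = card (\<Union>z\<in>V. {k. k < M \<and> c k = z})"
    by (metis card_lessThan)
  also have "\<dots> \<le> (\<Sum>z\<in>V. card {k. k < M \<and> c k = z})"
    using assms(1) by (rule card_UN_le)
  also have "\<dots> \<le> (\<Sum>z\<in>V. m)"
    using le by (rule sum_mono)
  finally show False using assms(3) by simp
qed

text \<open>
  The number \<open>M\<close> depends only on \<open>X\<close>, \<open>m\<close> and \<open>\<epsilon>\<close>, so \<open>\<delta>\<close> may be chosen afterwards such that the first
  \<open>M\<close> intervals of a cover for \<open>\<delta>\<close> are shorter than \<open>f M \<epsilon>\<close>. More than \<open>m\<close> of them start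
  in one cell of length \<open>f m \<epsilon> / 2\<close> and are swallowed by the interval with index \<open>m\<close>; the others
  can be permuted freely among the indices below \<open>M\<close>.
\<close>

lemma Micro_bounded_covered_atLeast:
  assumes f: "admissible f" and X: "X \<in> Micro f" "bounded X" and \<epsilon>: "\<epsilon> \<in> {0<..<1}"
  shows "covered {m..} (\<lambda>k. f k \<epsilon>) X"
proof (cases "X = {}")
  case False
  then obtain x0 where x0: "x0 \<in> X" by blast
  obtain b where b: "\<And>x. x \<in> X \<Longrightarrow> \<bar>x\<bar> \<le> b"
    using X(2) by (auto simp: bounded_iff)
  define e where "e = f m \<epsilon> / 2"
  have e: "e > 0" using admissible_pos[OF f \<epsilon>] by (simp add: e_def)
  \<comment> \<open>These are the cells of length \<open>e\<close> that meet
    \<open>{- b - 1..b}\<close>. The margin 1 bounds every interval length, so \<open>V\<close> does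
    not depend on \<open>\<delta>\<close>.\<close>
  define V where "V = {\<lfloor>(- b - 1) / e\<rfloor>..\<lfloor>b / e\<rfloor>}"
  \<comment> \<open>The term \<open>card V * m\<close> serves the pigeonhole principle;
    \<open>m + 1\<close> ensures \<open>m < M\<close>, so that \<open>{m}\<close>,
    \<open>{Suc m..<M}\<close> and \<open>{M..}\<close> partition \<open>{m..}\<close>.\<close>
  define M where "M = card V * m + m + 1"
  have "(f 0 \<longlongrightarrow> 0) (at_right 0)" using f by (simp add: admissible_def)
  moreover have "0 < min e (f M \<epsilon>)" using e admissible_pos[OF f \<epsilon>] by simp
  ultimately have "eventually (\<lambda>x. f 0 x < min e (f M \<epsilon>)) (at_right 0)"
    by (rule order_tendstoD(2))
  then obtain d where d: "d > 0" "\<And>x. 0 < x \<Longrightarrow> x < d \<Longrightarrow> f 0 x < min e (f M \<epsilon>)"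
    by (auto simp: eventually_at_right_field)
  define \<delta> where "\<delta> = min d \<epsilon> / 2"
  have \<delta>: "0 < \<delta>" "\<delta> < d" "\<delta> < \<epsilon>" "\<delta> \<in> {0<..<1}"
    using d(1) \<epsilon> by (auto simp: \<delta>_def)
  have f0: "f 0 \<delta> < e" "f 0 \<delta> < f M \<epsilon>" using d(2)[OF \<delta>(1,2)] by auto
  have f\<delta>: "f k \<delta> \<le> f 0 \<delta>" "0 < f k \<delta>" "f k \<delta> < 1" for k
    using admissible_antimono[OF f \<delta>(4)] admissible_pos[OF f \<delta>(4)] admissible_less_1[OF f \<delta>(4)]
    by auto
  obtain a where a: "X \<subseteq> (\<Union>k. {a k..a k + f k \<delta>})"
    using Micro_covered[OF f X(1) \<delta>(4)] unfolding covered_def by blast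
  \<comment> \<open>Intervals missing \<open>X\<close> are moved to \<open>x0\<close>, so that every
    left endpoint falls into a cell of \<open>V\<close>.\<close>
  define c where "c k = (if {a k..a k + f k \<delta>} \<inter> X = {} then x0 else a k)" for k
  define J where "J k = {c k..c k + f k \<delta>}" for k
  have XJ: "X \<subseteq> (\<Union>k. J k)"
  proof
    fix x assume x: "x \<in> X"
    then obtain k where k: "x \<in> {a k..a k + f k \<delta>}" using a by blast
    then have "c k = a k" using x by (auto simp: c_def)
    then have "x \<in> J k" using k by (simp add: J_def)
    then show "x \<in> (\<Union>k. J k)" by blast
  qed
  have c: "- b - 1 \<le> c k" "c k \<le> b" for k
  proof -
    have "- b - 1 \<le> c k \<and> c k \<le> b"
    proof (cases "{a k..a k + f k \<delta>} \<inter> X = {}")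
      case True
      then show ?thesis using b[OF x0] by (auto simp: c_def)
    next
      case False
      then obtain x where x: "x \<in> X" "x \<in> {a k..a k + f k \<delta>}" by blast
      then show ?thesis using False b[OF x(1)] f\<delta>(3)[of k] by (auto simp: c_def)
    qed
    then show "- b - 1 \<le> c k" "c k \<le> b" by auto
  qed
  have "\<exists>z\<in>V. m < card {k. k < M \<and> \<lfloor>c k / e\<rfloor> = z}"
  proof (rule ex_fibre_card_gt)
    fix k
    show "\<lfloor>c k / e\<rfloor> \<in> V"
      unfolding V_def using c[of k] e by (auto intro!: floor_mono divide_right_mono)
  qed (auto simp: V_def M_def)
  then obtain z where z: "m < card {k. k < M \<and> \<lfloor>c k / e\<rfloor> = z}" by blast
  define G where "G = {k. k < M \<and> \<lfloor>c k / e\<rfloor> = z}"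
  have G: "G \<subseteq> {..<M}" "m < card G" using z by (auto simp: G_def)
  have "covered {m} (\<lambda>k. f k \<epsilon>) (\<Union>k\<in>G. J k)"
  proof -
    have "(\<Union>k\<in>G. J k) \<subseteq> {z * e..z * e + f m \<epsilon>}"
    proof
      fix x assume "x \<in> (\<Union>k\<in>G. J k)"
      then obtain k where k: "\<lfloor>c k / e\<rfloor> = z" "c k \<le> x" "x \<le> c k + f k \<delta>"
        by (auto simp: G_def J_def)
      have "z \<le> c k / e" "c k / e < z + 1" using k(1) by linarith+
      then have "z * e \<le> c k" "c k < z * e + e"
        using e by (simp_all add: field_simps)
      then show "x \<in> {z * e..z * e + f m \<epsilon>}"
        using k f\<delta>(1)[of k] f0(1) by (simp add: e_def)
    qed
    then show ?thesis
      unfolding covered_def by (intro exI[of _ "\<lambda>_. z * e"]) simp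
  qed
  moreover have "covered {Suc m..<M} (\<lambda>k. f k \<epsilon>) (\<Union>k\<in>{..<M} - G. J k)"
  proof -
    \<comment> \<open>Since \<open>card G\<close> is at least \<open>m + 1\<close>, at most
      \<open>M - m - 1\<close> indices are left, which is the size of
      \<open>{Suc m..<M}\<close>.\<close>
    have "card ({..<M} - G) \<le> card {Suc m..<M}"
      using G by (subst card_Diff_subset) (auto intro: finite_subset)
    then obtain \<phi> where \<phi>: "\<phi> ` ({..<M} - G) \<subseteq> {Suc m..<M}" "inj_on \<phi> ({..<M} - G)"
      using card_le_inj[of "{..<M} - G" "{Suc m..<M}"] by auto
    have "covered ({..<M} - G) (\<lambda>k. f k \<delta>) (\<Union>k\<in>{..<M} - G. J k)"
      unfolding covered_def J_def by (intro exI[of _ c] order_refl)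
    then show ?thesis
    proof (rule covered_reindex[OF _ \<phi>(2,1)])
      fix k assume "k \<in> {..<M} - G"
      then have "\<phi> k \<le> M" using \<phi>(1) by fastforce
      then show "f k \<delta> \<le> f (\<phi> k) \<epsilon>"
        using f\<delta>(1)[of k] f0(2) admissible_antimono[OF f \<epsilon>, of "\<phi> k" M] by linarith
    qed
  qed
  ultimately have "covered ({m} \<union> {Suc m..<M}) (\<lambda>k. f k \<epsilon>)
      ((\<Union>k\<in>G. J k) \<union> (\<Union>k\<in>{..<M} - G. J k))"
    by (rule covered_Un) auto
  moreover have "covered {M..} (\<lambda>k. f k \<epsilon>) (\<Union>k\<in>{M..}. J k)"
  proof -
    have "covered {M..} (\<lambda>k. f k \<delta>) (\<Union>k\<in>{M..}. J k)"
      unfolding covered_def J_def by (intro exI[of _ c] order_refl)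
    then show ?thesis
      by (rule covered_mono)
        (use admissible_strict_mono[OF f \<delta>(1,3)] \<epsilon> in \<open>auto simp: less_imp_le\<close>)
  qed
  ultimately have "covered (({m} \<union> {Suc m..<M}) \<union> {M..}) (\<lambda>k. f k \<epsilon>)
      (((\<Union>k\<in>G. J k) \<union> (\<Union>k\<in>{..<M} - G. J k)) \<union> (\<Union>k\<in>{M..}. J k))"
    by (rule covered_Un) (auto simp: M_def)
  moreover have "({m} \<union> {Suc m..<M}) \<union> {M..} = {m..}"
    by (auto simp: M_def)
  moreover have "X \<subseteq> ((\<Union>k\<in>G. J k) \<union> (\<Union>k\<in>{..<M} - G. J k)) \<union> (\<Union>k\<in>{M..}. J k)"
  proof
    fix x assume "x \<in> X"
    then obtain k where k: "x \<in> J k" using XJ by blast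
    have "k \<in> G \<or> k \<in> {..<M} - G \<or> k \<in> {M..}" by auto
    then show "x \<in> ((\<Union>k\<in>G. J k) \<union> (\<Union>k\<in>{..<M} - G. J k)) \<union> (\<Union>k\<in>{M..}. J k)"
      using k by blast
  qed
  ultimately show ?thesis by (auto elim: covered_subset)
qed (simp add: covered_def)

section \<open>Union with a strong measure zero set\<close>

text \<open>\<open>X\<close> takes the indices in \<open>T\<close> and \<open>Y\<close> those in
  \<open>- T\<close>. Summability is known only near 0, so the cover is built for a smaller
  \<open>\<delta>\<close> and carried to \<open>\<epsilon>\<close> by monotonicity.\<close>

lemma Micro_Un_strong_measure_zero:
  assumes f: "admissible f" and Y: "strong_measure_zero Y"
    and X: "\<And>\<epsilon>. \<epsilon> \<in> {0<..<1} \<Longrightarrow> summable (\<lambda>k. f k \<epsilon>) \<Longrightarrow>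
      \<exists>T. infinite (- T) \<and> covered T (\<lambda>k. f k \<epsilon>) X"
  shows "X \<union> Y \<in> Micro f"
proof -
  have "\<exists>x0\<in>{0<..<1}. \<forall>x\<in>{0<..<x0}. summable (\<lambda>n. f n x)"
    using f by (simp add: admissible_def)
  then obtain x0 where x0: "x0 \<in> {0<..<1}" "\<forall>x\<in>{0<..<x0}. summable (\<lambda>n. f n x)"
    by (rule bexE)
  have "interval_cover (\<lambda>k. f k \<epsilon>) (X \<union> Y)" if \<epsilon>: "\<epsilon> \<in> {0<..<1}" for \<epsilon>
  proof -
    define \<delta> where "\<delta> = min \<epsilon> x0 / 2"
    have \<delta>: "\<delta> \<in> {0<..<1}" "\<delta> \<in> {0<..<x0}" "\<delta> < \<epsilon>"
      using \<epsilon> x0(1) by (auto simp: \<delta>_def)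
    obtain T where T: "infinite (- T)" "covered T (\<lambda>k. f k \<delta>) X"
      using X[OF \<delta>(1) bspec[OF x0(2) \<delta>(2)]] by blast
    have "covered (- T) (\<lambda>k. f k \<delta>) Y"
      using Y T(1) admissible_pos[OF f \<delta>(1)] by (rule strong_measure_zero_covered)
    with T(2) have "covered (T \<union> - T) (\<lambda>k. f k \<delta>) (X \<union> Y)"
      by (rule covered_Un) simp
    then have "covered UNIV (\<lambda>k. f k \<epsilon>) (X \<union> Y)"
      by (rule covered_mono) (use admissible_strict_mono[OF f _ \<delta>(3)] \<delta> \<epsilon> in \<open>auto simp: less_imp_le\<close>)
    then show ?thesis
      by (subst interval_cover_iff) (auto intro: less_imp_le admissible_pos[OF f \<epsilon>])
  qed
  then show ?thesis by (simp add: Micro_def)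
qed

text \<open>On an unbounded side there are points arbitrarily far out, and convexity fills the
  ray.\<close>

lemma is_interval_unbounded_cases:
  fixes C :: "real set"
  assumes "is_interval C" "\<not> bounded C"
  shows "(\<forall>q\<in>C. {q..} \<subseteq> C) \<or> (\<forall>q\<in>C. {..q} \<subseteq> C)"
proof (cases "bdd_above C")
  case True
  then have nb: "\<not> bdd_below C"
    using assms(2) bounded_subset[OF bounded_closed_interval, of C] unfolding bdd_above_def bdd_below_def
    by (metis atLeastAtMost_iff subsetI)
  have "t \<in> C" if "q \<in> C" "t \<le> q" for q t
  proof -
    obtain y where "y \<in> C" "y < t"
      using nb by (auto simp: bdd_below_def not_le)
    then show ?thesis
      using mem_is_interval_1_I[OF assms(1), of y q t] that by simp
  qed
  then show ?thesis by auto
next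
  case False
  have "t \<in> C" if "q \<in> C" "q \<le> t" for q t
  proof -
    obtain y where "y \<in> C" "t < y"
      using False by (auto simp: bdd_above_def not_le)
    then show ?thesis
      using mem_is_interval_1_I[OF assms(1), of q y t] that by simp
  qed
  then show ?thesis by auto
qed

theorem theorem3p4:
  fixes f :: "nat \<Rightarrow> real \<Rightarrow> real" and X Y :: "real set"
  assumes "admissible f"
    and "X \<in> Micro f"
    and "X \<in> star (Micro f) \<or>
         (is_interval (closure X) \<and> \<not> bounded (closure X)) \<or>
         bounded X"
    and "strong_measure_zero Y"
  shows "X \<union> Y \<in> Micro f"
proof (rule Micro_Un_strong_measure_zero[OF assms(1,4)])
  fix \<epsilon> assume \<epsilon>: "\<epsilon> \<in> {0<..<1::real}" and sum: "summable (\<lambda>k. f k \<epsilon>)"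
  \<comment> \<open>Any smaller positive value would do: the strict gap between
    \<open>f k \<delta>\<close> and \<open>f k \<epsilon>\<close> is the slack for the compactness
    and ray arguments.\<close>
  define \<delta> where "\<delta> = \<epsilon> / 2"
  have \<delta>: "\<delta> \<in> {0<..<1}" "0 < \<delta>" "\<delta> < \<epsilon>" using \<epsilon> by (auto simp: \<delta>_def)
  have less: "f k \<delta> < f k \<epsilon>" for k
    using admissible_strict_mono[OF assms(1) \<delta>(2,3)] \<epsilon> by simp
  consider "X \<in> star (Micro f)" | "is_interval (closure X)" "\<not> bounded (closure X)" | "bounded X"
    using assms(3) by blast
  then show "\<exists>T. infinite (- T) \<and> covered T (\<lambda>k. f k \<epsilon>) X"
  proof cases
    case 1
    then obtain F where F: "F \<in> Micro f" "fsigma F" "X \<subseteq> F"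
      by (auto simp: star_def)
    obtain K :: "nat \<Rightarrow> real set" where "range K \<subseteq> Collect compact" and KF: "F = (\<Union>n. K n)"
      using F(2) unfolding fsigma_Union_compact by blast
    then have K: "compact (K n)" for n by auto
    have "\<exists>T. infinite (- T) \<and> covered T (\<lambda>k. f k \<epsilon>) (\<Union>n. K n)"
    proof (rule sigma_covered_spare)
      fix n m
      have "covered UNIV (\<lambda>k. f k x) (K n)" if "x \<in> {0<..<1}" for x
        using Micro_covered[OF assms(1) F(1) that] by (rule covered_subset) (auto simp: KF)
      then have "K n \<in> Micro f"
        by (simp add: Micro_def interval_cover_iff less_imp_le[OF admissible_pos[OF assms(1)]])
      then have cov: "covered {Suc m..} (\<lambda>k. f k \<delta>) (K n)"
        using Micro_bounded_covered_atLeast[OF assms(1) _ compact_imp_bounded[OF K] \<delta>(1)] by blast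
      obtain T where T: "finite T" "T \<subseteq> {Suc m..}" "covered T (\<lambda>k. f k \<epsilon>) (K n)"
        using compact_covered_finite[OF K cov less] by blast
      \<comment> \<open>Inserting \<open>m\<close> ensures \<open>m < N\<close> even if
        \<open>T\<close> is empty.\<close>
      define N where "N = Suc (Max (insert m T))"
      have "k < N" if "k \<in> insert m T" for k
        unfolding N_def using T(1) that by (intro le_imp_less_Suc Max_ge) auto
      then have "m < N" "T \<subseteq> {Suc m..<N}" using T(2) by auto
      then show "\<exists>N>m. covered {Suc m..<N} (\<lambda>k. f k \<epsilon>) (K n)"
        by (intro exI[of _ N] conjI covered_mono[OF T(3)]) auto
    qed
    then obtain T where "infinite (- T)" "covered T (\<lambda>k. f k \<epsilon>) F"
      unfolding KF by blast
    then show ?thesis using covered_subset[OF _ F(3)] by blast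
  next
    case 2
    have half: "\<exists>T. infinite (- T) \<and> covered T (\<lambda>k. f k \<epsilon>) Z"
      if "covered UNIV (\<lambda>k. f k \<delta>) Z" "Z \<noteq> {}" "\<And>q. q \<in> closure Z \<Longrightarrow> {q..} \<subseteq> closure Z" for Z
    proof (rule unbounded_covered_spare[where g = "\<lambda>k. f k \<delta>" and h = "\<lambda>k. f k \<epsilon>"])
      show "summable (\<lambda>k. f k \<delta>)"
        using sum less admissible_pos[OF assms(1) \<delta>(1)]
        by (intro summable_comparison_test'[OF sum, of 0]) (auto simp: less_imp_le abs_of_pos)
    qed (use that in \<open>simp_all add: less less_imp_le admissible_pos[OF assms(1) \<delta>(1)]\<close>)
    have X: "covered UNIV (\<lambda>k. f k \<delta>) X" "X \<noteq> {}"
      using Micro_covered[OF assms(1,2) \<delta>(1)] 2 by auto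
    from is_interval_unbounded_cases[OF 2] show ?thesis
    proof
      assume "\<forall>q\<in>closure X. {q..} \<subseteq> closure X"
      then show ?thesis using half[OF X] by blast
    next
      \<comment> \<open>Reflection reduces a ray to the left to a ray to the right.\<close>
      assume *: "\<forall>q\<in>closure X. {..q} \<subseteq> closure X"
      have cl: "closure (uminus ` X) = uminus ` closure X"
        by (rule closure_injective_linear_image[symmetric]) (auto simp: linear_uminus)
      have "{q..} \<subseteq> closure (uminus ` X)" if "q \<in> closure (uminus ` X)" for q
      proof
        fix t assume "t \<in> {q..}"
        then have "- t \<in> closure X" using * that unfolding cl by fastforce
        then show "t \<in> closure (uminus ` X)" unfolding cl by (rule rev_image_eqI) simp
      qed
      then obtain T where "infinite (- T)" "covered T (\<lambda>k. f k \<epsilon>) (uminus ` X)"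
        using half[OF covered_uminus_image[OF X(1)]] X(2) by blast
      then show ?thesis
        using covered_uminus_image[of T _ "uminus ` X"] by (auto simp: image_image)
    qed
  next
    case 3
    \<comment> \<open>The choice \<open>m = 1\<close> leaves index 0 free for the accumulation
      point.\<close>
    show ?thesis
      using Micro_bounded_covered_atLeast[OF assms(1,2) 3 \<epsilon>] 3 admissible_pos[OF assms(1) \<epsilon>]
        summable_LIMSEQ_zero[OF sum]
      by (intro bounded_covered_spare) auto
  qed
qed

end
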